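(* Suppose that for each $t\in\mathcal{T}$ the price function is affine, $c_t(\ell)=\alpha_t+\beta_t\ell$ with $\alpha_t>0$ and $\beta_t>0$. Then, for any initial profile $\boldsymbol{\ell}^{(0)}\in\mathcal{L}$, the sequence of iterates $(\boldsymbol{\ell}^{(k)})_{k\ge0}$ of the Cycling Best Response Dynamics (CBRD) converges to the unique Nash equilibrium $\boldsymbol{\ell}^{\mathrm{NE}}$ of the consumption game $\mathcal{G}$. Moreover, for all $k\ge1$, $$\big\|\boldsymbol{\ell}^{(k)}-\boldsymbol{\ell}^{\mathrm{NE}}\big\|_2\le C\,\frac{\sqrt{M}\,N}{\sqrt{a}}\times\frac{1}{\sqrt{k}},$$ where $C$ is a constant (independent of $k$) which depends on $\boldsymbol{\ell}^{(0)}$ and the billing functions $(b_n)_n$, $M=2\max_{t}\beta_t$ and $a=2\min_t\beta_t$.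
   Context: Let $\mathcal{N}=\{1,\dots,N\}$ be a finite set of consumers (players) and $\mathcal{T}=\{1,\dots,T\}$ a finite set of time periods. For each $n\in\mathcal{N}$ we are given a total energy demand $E_n$ and bounds $0\le\underline{\ell}_{n,t}\le\overline{\ell}_{n,t}$, $t\in\mathcal{T}$. The feasible set of player $n$ is $$\mathcal{L}_n=\Big\{\boldsymbol{\ell}_n=(\ell_{n,1},\dots,\ell_{n,T})\in\mathbb{R}^T:\ \sum_{t\in\mathcal{T}}\ell_{n,t}=E_n,\ \ \underline{\ell}_{n,t}\le \ell_{n,t}\le\overline{\ell}_{n,t}\ \ \forall t\in\mathcal{T}\Big\},$$ assumed nonempty, and $\mathcal{L}=\mathcal{L}_1\times\dots\times\mathcal{L}_N$. For a profile $\boldsymbol{\ell}=(\boldsymbol{\ell}_n)_{n\in\mathcal{N}}$, put $L_t=\sum_{n\in\mathcal{N}}\ell_{n,t}$, and write $\boldsymbol{\ell}_{-n}=(\boldsymbol{\ell}_m)_{m\ne n}$. Each time period $t$ has a per-unit price function $c_t$. Player $n$ minimizes over $\boldsymbol{\ell}_n\in\mathcal{L}_n$ the bill $$b_n(\boldsymbol{\ell}_n,\boldsymbol{\ell}_{-n})=\sum_{t\in\mathcal{T}}\ell_{n,t}\,c_t(L_t).$$ The minimization game is $\mathcal{G}=(\mathcal{N},\mathcal{L},(b_n)_n)$. A Nash equilibrium of $\mathcal{G}$ is a profile $\boldsymbol{\ell}^{\mathrm{NE}}\in\mathcal{L}$ such that for every $n\in\mathcal{N}$ and every $\boldsymbol{\ell}_n\in\mathcal{L}_n$,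 $b_n(\boldsymbol{\ell}^{\mathrm{NE}}_n,\boldsymbol{\ell}^{\mathrm{NE}}_{-n})\le b_n(\boldsymbol{\ell}_n,\boldsymbol{\ell}^{\mathrm{NE}}_{-n})$. The best response of player $n$ to the load $\boldsymbol{s}_n=(s_{n,t})_t\in\mathbb{R}^T$ of the others is $$\mathrm{BR}_n(\boldsymbol{s}_n)=\arg\min_{\boldsymbol{\ell}_n\in\mathcal{L}_n}\sum_{t\in\mathcal{T}}\ell_{n,t}\,c_t(s_{n,t}+\ell_{n,t}).$$ Cycling Best Response Dynamics (CBRD, considered without stopping criterion): starting from $\boldsymbol{\ell}^{(0)}\in\mathcal{L}$, for $k=0,1,2,\dots$, successively for $n=1,\dots,N$ set $\boldsymbol{s}_n^{(k)}=\sum_{m<n}\boldsymbol{\ell}_m^{(k+1)}+\sum_{m>n}\boldsymbol{\ell}_m^{(k)}$ and $\boldsymbol{\ell}_n^{(k+1)}=\mathrm{BR}_n(\boldsymbol{s}_n^{(k)})$. *)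

theory Defs
  imports "HOL-Analysis.Analysis"
begin

text \<open>
  Players are the elements of a finite linearly ordered type \<open>'n\<close>, which plays the role of
  \<open>{1, ..., N}\<close> with its usual order, \<open>N = CARD('n)\<close>; time periods form a finite type \<open>'t\<close>.
  A profile is an element \<open>l\<close> of \<open>real ^ 't ^ 'n\<close>, with \<open>l $ n\<close> the load vector of player \<open>n\<close>,
  so that its \<open>norm\<close> is the Euclidean norm of the vector of all the \<open>l $ n $ t\<close>.
\<close>

definition feasible ::
  "('n \<Rightarrow> real) \<Rightarrow> ('n \<Rightarrow> 't \<Rightarrow> real) \<Rightarrow> ('n \<Rightarrow> 't \<Rightarrow> real) \<Rightarrow> 'n \<Rightarrow> (real ^ 't::finite) set" where
  "feasible E lo up n =
     {x. (\<Sum>t\<in>UNIV. x $ t) = E n \<and> (\<forall>t. lo n t \<le> x $ t \<and> x $ t \<le> up n t)}"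

definition profiles :: "('n \<Rightarrow> (real ^ 't) set) \<Rightarrow> (real ^ 't::finite ^ 'n::finite) set" where
  "profiles X = {l. \<forall>n. l $ n \<in> X n}"

definition total_load :: "real ^ 't ^ 'n \<Rightarrow> 't::finite \<Rightarrow> real" where
  "total_load l t = (\<Sum>n\<in>(UNIV :: 'n::finite set). l $ n $ t)"

definition bill :: "('t \<Rightarrow> real \<Rightarrow> real) \<Rightarrow> 'n \<Rightarrow> real ^ 't::finite ^ 'n::finite \<Rightarrow> real" where
  "bill c n l = (\<Sum>t\<in>UNIV. l $ n $ t * c t (total_load l t))"

definition deviate ::
  "real ^ 't ^ 'n \<Rightarrow> 'n \<Rightarrow> real ^ 't \<Rightarrow> real ^ 't::finite ^ 'n::finite" where
  "deviate l n x = (\<chi> m. if m = n then x else l $ m)"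

definition nash_equilibrium ::
  "('t \<Rightarrow> real \<Rightarrow> real) \<Rightarrow> ('n \<Rightarrow> (real ^ 't) set) \<Rightarrow> real ^ 't::finite ^ 'n::finite \<Rightarrow> bool" where
  "nash_equilibrium c X l \<longleftrightarrow>
     l \<in> profiles X \<and> (\<forall>n. \<forall>x\<in>X n. bill c n l \<le> bill c n (deviate l n x))"

definition best_response ::
  "('t \<Rightarrow> real \<Rightarrow> real) \<Rightarrow> ('n \<Rightarrow> (real ^ 't) set) \<Rightarrow> 'n \<Rightarrow> real ^ 't \<Rightarrow> (real ^ 't::finite) set" where
  "best_response c X n s =
     {x. is_arg_min (\<lambda>y. \<Sum>t\<in>UNIV. y $ t * c t (s $ t + y $ t)) (\<lambda>y. y \<in> X n) x}"

text \<open>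
  The argmin is a set, so the dynamics are a relation: \<open>cbrd c X l0 l\<close> says that \<open>l\<close> is a sequence
  of iterates started at \<open>l0\<close>. The update is sequential within a cycle, since the load faced
  by \<open>n\<close> uses the new iterates of the players below \<open>n\<close>.
\<close>

definition cbrd ::
  "('t \<Rightarrow> real \<Rightarrow> real) \<Rightarrow> ('n::{finite,linorder} \<Rightarrow> (real ^ 't) set) \<Rightarrow> real ^ 't ^ 'n::{finite,linorder}
     \<Rightarrow> (nat \<Rightarrow> real ^ 't::finite ^ 'n::{finite,linorder}) \<Rightarrow> bool" where
  "cbrd c X l0 l \<longleftrightarrow> l 0 = l0 \<and>
     (\<forall>k n. l (Suc k) $ n \<in>
        best_response c X n ((\<Sum>m | m < n. l (Suc k) $ m) + (\<Sum>m | m > n. l k $ m)))"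

end

theory Submission imports Defs begin

text \<open>
  The game has the exact potential
  \<open>\<Phi>(l) = \<Sum>t. \<alpha> t * L t + \<beta> t / 2 * ((L t)\<^sup>2 + (\<Sum>n. (l n t)\<^sup>2))\<close>, which is strongly convex with respect to
  the weighted norm \<open>W(d) = \<Sum>t. \<beta> t * (\<Sum>n. (d n t)\<^sup>2)\<close>; so Nash equilibria are minimizers, and
  \<open>W(l - lNE) \<le> 2 (\<Phi>(l) - \<Phi>(lNE))\<close>. For one cycle \<open>x \<mapsto> y\<close>, add up the variational inequalities of the
  best responses. Tested against \<open>x\<close> they give \<open>\<Phi>(x) - \<Phi>(y) \<ge> W(x - y)\<close>; tested against \<open>lNE\<close> they give
  \<open>\<Phi>(y) - \<Phi>(lNE) \<le> (N\<^sup>2 / 2) W(x - y)\<close>. Hence the gaps \<open>\<delta> k = \<Phi>(l k) - \<Phi>(lNE)\<close> are decreasing and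
  satisfy \<open>\<delta> (k + 1) \<le> (N\<^sup>2 / 2) (\<delta> k - \<delta> (k + 1))\<close>, which telescopes to \<open>k * \<delta> k \<le> (N\<^sup>2 / 2) \<delta> 0\<close>.
  Finally \<open>\<delta> 0 \<le> \<Phi>(l0)\<close> because loads are nonnegative.
\<close>

section \<open>Algebraic and first-order tools\<close>

text \<open>Pairs below and above the diagonal contribute equally. Keeping only the pairs with
  \<open>m > n\<close> matches the order of play: these are the moves made after \<open>n\<close>
  has responded.\<close>

lemma square_sum_linorder:
  fixes d :: "'n::{finite,linorder} \<Rightarrow> 'a::comm_ring_1"
  shows "(\<Sum>n\<in>UNIV. d n)\<^sup>2 = (\<Sum>n\<in>UNIV. (d n)\<^sup>2) + 2 * (\<Sum>n\<in>UNIV. d n * (\<Sum>m | m > n. d m))"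
proof -
  have split: "(\<Sum>m\<in>UNIV. d m) = (\<Sum>m | m < n. d m) + d n + (\<Sum>m | m > n. d m)" for n
  proof -
    have "(UNIV :: 'n set) = insert n ({m. m < n} \<union> {m. m > n})"
      by auto
    then have "(\<Sum>m\<in>UNIV. d m) = d n + (\<Sum>m\<in>{m. m < n} \<union> {m. m > n}. d m)"
      by (metis (no_types, lifting) finite sum.insert Un_iff mem_Collect_eq less_irrefl)
    also have "(\<Sum>m\<in>{m. m < n} \<union> {m. m > n}. d m) = (\<Sum>m | m < n. d m) + (\<Sum>m | m > n. d m)"
      by (intro sum.union_disjoint) auto
    finally show ?thesis by (simp add: algebra_simps)
  qed
  have "(\<Sum>n\<in>UNIV. d n * (\<Sum>m | m < n. d m)) = (\<Sum>n\<in>UNIV. \<Sum>m\<in>UNIV. if m < n then d n * d m else 0)"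
    by (simp add: sum_distrib_left sum.If_cases)
  also have "\<dots> = (\<Sum>m\<in>UNIV. \<Sum>n\<in>UNIV. if m < n then d n * d m else 0)"
    by (rule sum.swap)
  also have "\<dots> = (\<Sum>n\<in>UNIV. d n * (\<Sum>m | m > n. d m))"
    by (simp add: sum_distrib_left sum.If_cases mult.commute)
  finally have swap: "(\<Sum>n\<in>UNIV. d n * (\<Sum>m | m < n. d m)) = (\<Sum>n\<in>UNIV. d n * (\<Sum>m | m > n. d m))" .
  have "(\<Sum>n\<in>UNIV. d n)\<^sup>2 = (\<Sum>n\<in>UNIV. d n * (\<Sum>m\<in>UNIV. d m))"
    by (simp add: power2_eq_square sum_distrib_right)
  also have "\<dots> = (\<Sum>n\<in>UNIV. (d n)\<^sup>2 + d n * (\<Sum>m | m < n. d m) + d n * (\<Sum>m | m > n. d m))"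
    by (intro sum.cong refl, subst split) (simp add: algebra_simps power2_eq_square)
  finally show ?thesis
    by (simp add: sum.distrib swap)
qed

text \<open>Divide by \<open>e\<close> and let it tend to 0 from the right. This extracts
  first-order optimality from minimality along a segment.\<close>

lemma nonneg_if_perturbation_nonneg:
  fixes p q :: real
  assumes "\<And>e. 0 < e \<Longrightarrow> e \<le> 1 \<Longrightarrow> 0 \<le> e * p + e\<^sup>2 * q"
  shows "0 \<le> p"
proof (rule tendsto_lowerbound)
  show "((\<lambda>e. p + e * q) \<longlongrightarrow> p) (at_right 0)"
    by (auto intro!: tendsto_eq_intros)
  have "eventually (\<lambda>e::real. e \<in> {0<..<1}) (at_right 0)"
    by (rule eventually_at_right_real) simp
  then show "\<forall>\<^sub>F e in at_right 0. 0 \<le> p + e * q"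
  proof eventually_elim
    case (elim e)
    then have "0 \<le> e * (p + e * q)"
      using assms[of e] by (simp add: algebra_simps power2_eq_square)
    then show ?case
      using elim by (simp add: zero_le_mult_iff)
  qed
qed simp

section \<open>Convexity and compactness of the strategy sets\<close>

lemma convex_feasible:
  fixes lo up :: "'n \<Rightarrow> 't::finite \<Rightarrow> real"
  shows "convex (feasible E lo up n)"
proof (rule convexI)
  fix x y :: "real^'t" and u v :: real
  assume x: "x \<in> feasible E lo up n" and y: "y \<in> feasible E lo up n"
    and uv: "0 \<le> u" "0 \<le> v" "u + v = 1"
  have "(\<Sum>t\<in>UNIV. (u *\<^sub>R x + v *\<^sub>R y) $ t) = u * E n + v * E n"
    using x y by (simp add: feasible_def sum.distrib flip: sum_distrib_left)
  also have "\<dots> = E n"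
    using uv by (simp flip: distrib_right)
  finally have sum: "(\<Sum>t\<in>UNIV. (u *\<^sub>R x + v *\<^sub>R y) $ t) = E n" .
  have "(u *\<^sub>R x + v *\<^sub>R y) $ t \<in> {lo n t..up n t}" for t
  proof -
    have "u *\<^sub>R (x $ t) + v *\<^sub>R (y $ t) \<in> {lo n t..up n t}"
      using x y uv by (intro convexD) (auto simp: feasible_def)
    then show ?thesis by simp
  qed
  with sum show "u *\<^sub>R x + v *\<^sub>R y \<in> feasible E lo up n"
    by (simp add: feasible_def)
qed

lemma compact_feasible:
  fixes lo up :: "'n \<Rightarrow> 't::finite \<Rightarrow> real"
  shows "compact (feasible E lo up n)"
proof -
  have "feasible E lo up n = {x. (\<Sum>t\<in>UNIV. x $ t) = E n} \<inter> cbox (\<chi> t. lo n t) (\<chi> t. up n t)"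
    by (auto simp: feasible_def mem_box_cart)
  moreover have "closed {x :: real^'t. (\<Sum>t\<in>UNIV. x $ t) = E n}"
    by (intro closed_Collect_eq continuous_intros)
  ultimately show ?thesis
    by (simp add: closed_Int_compact)
qed

text \<open>A finite product of compact sets, treated as bounded and closed: the norm of a profile
  is at most the sum of its block norms, and closedness is checked block by block.\<close>

lemma compact_profiles:
  fixes X :: "'n::finite \<Rightarrow> (real ^ 't::finite) set"
  assumes "\<And>n. compact (X n)"
  shows "compact (profiles X)"
proof -
  have "\<exists>K. \<forall>x\<in>X n. norm x \<le> K" for n
    using compact_imp_bounded[OF assms] by (auto simp: bounded_iff)
  then obtain K where K: "\<And>n x. x \<in> X n \<Longrightarrow> norm x \<le> K n"
    by metis
  have "norm l \<le> (\<Sum>n\<in>UNIV. K n)" if "l \<in> profiles X" for l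
    using that
    by (intro order_trans[OF L2_set_le_sum[of UNIV "\<lambda>n. norm (l $ n)", folded norm_vec_def]] sum_mono K)
       (auto simp: profiles_def)
  then have "bounded (profiles X)"
    by (auto simp: bounded_iff)
  moreover have "profiles X = (\<Inter>n. {l. l $ n \<in> X n})"
    by (auto simp: profiles_def)
  moreover have "closed {l :: real^'t^'n. l $ n \<in> X n}" for n
    using continuous_closed_vimage[OF compact_imp_closed[OF assms], of "\<lambda>l. l $ n" n]
    by (simp add: vimage_def)
  ultimately show ?thesis
    by (auto simp: compact_eq_bounded_closed)
qed

section \<open>The weighted norm, and equilibria as mutual best responses\<close>

text \<open>The weights are the curvatures of the potential, so one-cycle estimates stay free of
  ratios of the \<beta> values; the smallest \<beta> enters only on passing to the Euclidean
  norm.\<close>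

definition weighted_sq :: "('t \<Rightarrow> real) \<Rightarrow> real ^ 't::finite ^ 'n::finite \<Rightarrow> real" where
  "weighted_sq \<beta> d = (\<Sum>t\<in>UNIV. \<beta> t * (\<Sum>n\<in>UNIV. (d $ n $ t)\<^sup>2))"

lemma weighted_sq_nonneg:
  assumes "\<And>t. 0 < \<beta> t"
  shows "0 \<le> weighted_sq \<beta> d"
  unfolding weighted_sq_def by (intro sum_nonneg mult_nonneg_nonneg less_imp_le[OF assms] zero_le_power2)

lemma norm_sq_le_weighted_sq:
  "(MIN t. \<beta> t) * (norm d)\<^sup>2 \<le> weighted_sq \<beta> d"
proof -
  have "(norm d)\<^sup>2 = (\<Sum>n\<in>UNIV. \<Sum>t\<in>UNIV. (d $ n $ t)\<^sup>2)"
    by (simp add: norm_vec_def L2_set_def sum_nonneg)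
  also have "\<dots> = (\<Sum>t\<in>UNIV. \<Sum>n\<in>UNIV. (d $ n $ t)\<^sup>2)"
    by (rule sum.swap)
  finally show ?thesis
    unfolding weighted_sq_def by (auto simp: sum_distrib_left intro!: sum_mono mult_right_mono)
qed

lemma total_load_eq: "total_load l t = (\<Sum>m | m \<noteq> n. l $ m) $ t + l $ n $ t"
proof -
  have "total_load l t = l $ n $ t + (\<Sum>m\<in>UNIV - {n}. l $ m $ t)"
    unfolding total_load_def by (rule sum.remove) auto
  moreover have "UNIV - {n} = {m. m \<noteq> n}"
    by auto
  ultimately show ?thesis by simp
qed

lemma total_load_split:
  fixes l :: "real ^ 't::finite ^ 'n::{finite,linorder}"
  shows "total_load l t = (\<Sum>m | m < n. l $ m $ t) + l $ n $ t + (\<Sum>m | m > n. l $ m $ t)"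
proof -
  have others: "{m. m \<noteq> n} = {m. m < n} \<union> {m. m > n}"
    by auto
  have "(\<Sum>m | m \<noteq> n. l $ m $ t) = (\<Sum>m | m < n. l $ m $ t) + (\<Sum>m | m > n. l $ m $ t)"
    unfolding others by (intro sum.union_disjoint) auto
  then show ?thesis
    using total_load_eq[of l t n] by simp
qed

text \<open>A deviation of \<open>n\<close> leaves the load of the others unchanged, so the deviated
  bill is the best-response objective. This makes the variational inequality for best responses
  available at equilibria.\<close>

lemma nash_equilibrium_iff_best_response:
  "nash_equilibrium c X l \<longleftrightarrow> (\<forall>n. l $ n \<in> best_response c X n (\<Sum>m | m \<noteq> n. l $ m))"
proof -
  have sum: "(\<Sum>m | m \<noteq> n. deviate l n x $ m $ t) = (\<Sum>m | m \<noteq> n. l $ m $ t)" for n x t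
    by (intro sum.cong) (auto simp: deviate_def)
  have dev: "bill c n (deviate l n x) = (\<Sum>t\<in>UNIV. x $ t * c t ((\<Sum>m | m \<noteq> n. l $ m) $ t + x $ t))" for n x
    unfolding bill_def total_load_eq[where n = n] sum_component sum by (simp add: deviate_def)
  have bill: "bill c n l = (\<Sum>t\<in>UNIV. l $ n $ t * c t ((\<Sum>m | m \<noteq> n. l $ m) $ t + l $ n $ t))" for n
    unfolding bill_def total_load_eq[where n = n] ..
  show ?thesis
    unfolding nash_equilibrium_def best_response_def profiles_def is_arg_min_linorder mem_Collect_eq
      dev bill by blast
qed

section \<open>Best responses under affine prices\<close>

locale affine_prices =
  fixes c :: "'t::finite \<Rightarrow> real \<Rightarrow> real" and \<alpha> \<beta> :: "'t \<Rightarrow> real"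
  assumes affine_price: "\<And>t x. c t x = \<alpha> t + \<beta> t * x"
    and \<alpha>_pos: "\<And>t. \<alpha> t > 0"
    and \<beta>_pos: "\<And>t. \<beta> t > 0"
begin

text \<open>Second-order Taylor expansion at \<open>x\<close>, exact because the cost is
  quadratic.\<close>

lemma cost_diff:
  "(\<Sum>t\<in>UNIV. y $ t * c t (s $ t + y $ t)) - (\<Sum>t\<in>UNIV. x $ t * c t (s $ t + x $ t)) =
   (\<Sum>t\<in>UNIV. (\<alpha> t + \<beta> t * (s $ t + 2 * x $ t)) * (y $ t - x $ t))
     + (\<Sum>t\<in>UNIV. \<beta> t * (y $ t - x $ t)\<^sup>2)"
  unfolding affine_price sum_subtractf[symmetric] sum.distrib[symmetric]
  by (intro sum.cong refl) (simp add: algebra_simps power2_eq_square)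

text \<open>Sufficiency: the quadratic remainder is nonnegative. Necessity: at step \<open>e\<close>
  towards \<open>y\<close> the linear part scales by \<open>e\<close> and the remainder by its
  square, so the linear part alone must be nonnegative.\<close>

lemma best_response_iff:
  assumes "convex (X n)"
  shows "x \<in> best_response c X n s \<longleftrightarrow> x \<in> X n \<and>
    (\<forall>y\<in>X n. 0 \<le> (\<Sum>t\<in>UNIV. (\<alpha> t + \<beta> t * (s $ t + 2 * x $ t)) * (y $ t - x $ t)))"
    (is "_ \<longleftrightarrow> _ \<and> (\<forall>y\<in>_. 0 \<le> ?D y)")
proof -
  let ?J = "\<lambda>y. \<Sum>t\<in>UNIV. y $ t * c t (s $ t + y $ t)"
  let ?Q = "\<lambda>y. \<Sum>t\<in>UNIV. \<beta> t * (y $ t - x $ t)\<^sup>2"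
  have J: "?J x \<le> ?J y \<longleftrightarrow> 0 \<le> ?D y + ?Q y" for y
    using cost_diff[of y s x] by linarith
  have BR: "x \<in> best_response c X n s \<longleftrightarrow> x \<in> X n \<and> (\<forall>y\<in>X n. 0 \<le> ?D y + ?Q y)"
    unfolding best_response_def is_arg_min_linorder mem_Collect_eq J by blast
  have Q: "0 \<le> ?Q y" for y
    by (intro sum_nonneg mult_nonneg_nonneg less_imp_le[OF \<beta>_pos]) simp
  have "0 \<le> ?D y" if x: "x \<in> X n" and opt: "\<forall>y\<in>X n. 0 \<le> ?D y + ?Q y" and y: "y \<in> X n" for y
  proof (rule nonneg_if_perturbation_nonneg)
    fix e :: real assume e: "0 < e" "e \<le> 1"
    let ?z = "(1 - e) *\<^sub>R x + e *\<^sub>R y"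
    have "?z \<in> X n"
      using assms x y e by (intro convexD) auto
    then have "0 \<le> ?D ?z + ?Q ?z"
      using opt by blast
    also have "?D ?z = e * ?D y"
      unfolding sum_distrib_left by (intro sum.cong refl) (simp add: algebra_simps)
    also have "?Q ?z = e\<^sup>2 * ?Q y"
      unfolding sum_distrib_left by (intro sum.cong refl) (simp add: algebra_simps power2_eq_square)
    finally show "0 \<le> e * ?D y + e\<^sup>2 * ?Q y" .
  qed
  then show ?thesis
    unfolding BR using Q by (meson add_nonneg_nonneg)
qed

text \<open>Existence is by compactness. For uniqueness, the variational inequality at one minimizer
  forces the quadratic remainder towards the other to vanish, and every \<beta> is positive.\<close>

lemma ex1_best_response:
  assumes "convex (X n)" "compact (X n)" "X n \<noteq> {}"
  shows "\<exists>!x. x \<in> best_response c X n s"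
proof (rule ex_ex1I)
  have "continuous_on (X n) (\<lambda>y. \<Sum>t\<in>UNIV. y $ t * c t (s $ t + y $ t))"
    unfolding affine_price by (intro continuous_intros)
  from continuous_attains_inf[OF assms(2,3) this] show "\<exists>x. x \<in> best_response c X n s"
    unfolding best_response_def is_arg_min_linorder by blast
next
  let ?J = "\<lambda>y. \<Sum>t\<in>UNIV. y $ t * c t (s $ t + y $ t)"
  fix x y assume x: "x \<in> best_response c X n s" and y: "y \<in> best_response c X n s"
  have "y \<in> X n" and "?J y \<le> ?J x"
    using x y by (auto simp: best_response_def is_arg_min_linorder)
  moreover from this x have
    "0 \<le> (\<Sum>t\<in>UNIV. (\<alpha> t + \<beta> t * (s $ t + 2 * x $ t)) * (y $ t - x $ t))"
    by (simp add: best_response_iff[of X n, OF assms(1)])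
  ultimately have "(\<Sum>t\<in>UNIV. \<beta> t * (y $ t - x $ t)\<^sup>2) \<le> 0"
    using cost_diff[of y s x] by linarith
  moreover have nonneg: "0 \<le> \<beta> t * (y $ t - x $ t)\<^sup>2" for t
    using \<beta>_pos[of t] by simp
  ultimately have "(\<Sum>t\<in>UNIV. \<beta> t * (y $ t - x $ t)\<^sup>2) = 0"
    by (intro antisym sum_nonneg)
  then have "\<beta> t * (y $ t - x $ t)\<^sup>2 = 0" for t
    using nonneg by (simp add: sum_nonneg_eq_0_iff)
  moreover have "\<beta> t \<noteq> 0" for t
    using \<beta>_pos[of t] by simp
  ultimately show "x = y"
    by (simp add: vec_eq_iff)
qed

section \<open>The exact potential and the equilibrium\<close>

text \<open>The partial derivative in \<open>l $ n $ t\<close> is \<alpha> + \<beta> (L + l), taken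
  at period \<open>t\<close>: exactly the marginal bill of player \<open>n\<close>.\<close>

definition potential :: "real ^ 't ^ 'n::finite \<Rightarrow> real" where
  "potential l = (\<Sum>t\<in>UNIV. \<alpha> t * total_load l t
     + \<beta> t / 2 * ((total_load l t)\<^sup>2 + (\<Sum>n\<in>UNIV. (l $ n $ t)\<^sup>2)))"

text \<open>Exact Taylor expansion again. The two squares stay separate because later estimates drop
  or expand the total-load square while using the weighted norm.\<close>

lemma potential_diff:
  "potential y - potential x =
    (\<Sum>n\<in>UNIV. \<Sum>t\<in>UNIV. (\<alpha> t + \<beta> t * (total_load x t + x $ n $ t)) * (y $ n $ t - x $ n $ t))
    + (\<Sum>t\<in>UNIV. \<beta> t * (total_load (y - x) t)\<^sup>2) / 2 + weighted_sq \<beta> (y - x) / 2"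
proof -
  have "(\<alpha> t * total_load y t + \<beta> t / 2 * ((total_load y t)\<^sup>2 + (\<Sum>n\<in>UNIV. (y $ n $ t)\<^sup>2)))
      - (\<alpha> t * total_load x t + \<beta> t / 2 * ((total_load x t)\<^sup>2 + (\<Sum>n\<in>UNIV. (x $ n $ t)\<^sup>2)))
    = (\<Sum>n\<in>UNIV. (\<alpha> t + \<beta> t * (total_load x t + x $ n $ t)) * (y $ n $ t - x $ n $ t))
      + \<beta> t * (total_load (y - x) t)\<^sup>2 / 2 + \<beta> t * (\<Sum>n\<in>UNIV. ((y - x) $ n $ t)\<^sup>2) / 2" for t
  proof -
    have loads: "total_load y t - total_load x t = (\<Sum>n\<in>UNIV. y $ n $ t - x $ n $ t)"
      by (simp add: total_load_def sum_subtractf)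
    have lin: "(\<Sum>n\<in>UNIV. (\<alpha> t + \<beta> t * (total_load x t + x $ n $ t)) * (y $ n $ t - x $ n $ t))
      = (\<alpha> t + \<beta> t * total_load x t) * (total_load y t - total_load x t)
        + \<beta> t * (\<Sum>n\<in>UNIV. x $ n $ t * (y $ n $ t - x $ n $ t))"
      unfolding loads sum_distrib_left sum.distrib[symmetric]
      by (intro sum.cong refl) (simp add: algebra_simps)
    have load: "total_load (y - x) t = total_load y t - total_load x t"
      by (simp add: total_load_def sum_subtractf)
    have sq: "(\<Sum>n\<in>UNIV. (y $ n $ t)\<^sup>2) = (\<Sum>n\<in>UNIV. (x $ n $ t)\<^sup>2)
        + 2 * (\<Sum>n\<in>UNIV. x $ n $ t * (y $ n $ t - x $ n $ t)) + (\<Sum>n\<in>UNIV. ((y - x) $ n $ t)\<^sup>2)"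
      unfolding sum_distrib_left sum.distrib[symmetric]
      by (intro sum.cong refl) (simp add: algebra_simps power2_eq_square)
    show ?thesis
      unfolding lin load sq by (simp add: field_simps power2_eq_square)
  qed
  then show ?thesis
    unfolding potential_def weighted_sq_def sum_subtractf[symmetric]
    by (subst sum.swap) (simp add: sum.distrib sum_divide_distrib)
qed

text \<open>When only \<open>n\<close> moves, both squares of the expansion reduce to that of the
  single move, and their halves add up to the quadratic term of the bill.\<close>

lemma potential_deviate:
  "potential (deviate l n x) - potential l = bill c n (deviate l n x) - bill c n l"
proof -
  let ?d = "deviate l n x" and ?s = "\<Sum>m | m \<noteq> n. l $ m"
  have comp: "?d $ m $ t - l $ m $ t = (if m = n then x $ t - l $ n $ t else 0)" for m t
    by (simp add: deviate_def)
  have comp2: "((?d - l) $ m $ t)\<^sup>2 = (if m = n then (x $ t - l $ n $ t)\<^sup>2 else 0)" for m t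
    by (simp add: deviate_def)
  have load: "total_load (?d - l) t = x $ t - l $ n $ t" for t
    by (simp add: total_load_def comp)
  have "total_load ?d t = ?s $ t + x $ t" for t
  proof -
    have "(\<Sum>m | m \<noteq> n. ?d $ m) = ?s"
      by (intro sum.cong) (auto simp: deviate_def)
    then show ?thesis
      unfolding total_load_eq[of ?d t n] by (simp add: deviate_def)
  qed
  then have "bill c n ?d - bill c n l =
      (\<Sum>t\<in>UNIV. (\<alpha> t + \<beta> t * (?s $ t + 2 * l $ n $ t)) * (x $ t - l $ n $ t))
      + (\<Sum>t\<in>UNIV. \<beta> t * (x $ t - l $ n $ t)\<^sup>2)"
    unfolding cost_diff[symmetric] bill_def by (simp add: total_load_eq[of l _ n] deviate_def)
  moreover have "potential ?d - potential l =
      (\<Sum>t\<in>UNIV. (\<alpha> t + \<beta> t * (total_load l t + l $ n $ t)) * (x $ t - l $ n $ t))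
      + (\<Sum>t\<in>UNIV. \<beta> t * (x $ t - l $ n $ t)\<^sup>2)"
    unfolding potential_diff weighted_sq_def comp2 load
    by (subst sum.swap) (simp add: comp if_distrib cong: if_cong)
  ultimately show ?thesis
    by (simp add: total_load_eq[of l _ n] algebra_simps)
qed

text \<open>The players' variational inequalities at \<open>z\<close> sum to a nonnegative linear
  term; of the quadratic part only the weighted half is kept.\<close>

lemma potential_gap_nash:
  assumes "\<And>n. convex (X n)" "nash_equilibrium c X z" "l \<in> profiles X"
  shows "weighted_sq \<beta> (l - z) \<le> 2 * (potential l - potential z)"
proof -
  have "0 \<le> (\<Sum>t\<in>UNIV. (\<alpha> t + \<beta> t * (total_load z t + z $ n $ t)) * (l $ n $ t - z $ n $ t))" for n
  proof -
    have "z $ n \<in> best_response c X n (\<Sum>m | m \<noteq> n. z $ m)"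
      using assms(2) by (simp add: nash_equilibrium_iff_best_response)
    moreover have "l $ n \<in> X n"
      using assms(3) by (simp add: profiles_def)
    moreover have "(\<Sum>m | m \<noteq> n. z $ m) $ t + 2 * z $ n $ t = total_load z t + z $ n $ t" for t
      by (simp add: total_load_eq[of z t n])
    ultimately show ?thesis
      using best_response_iff[of X n "z $ n" "\<Sum>m | m \<noteq> n. z $ m"] assms(1)
      by (simp del: sum_component)
  qed
  moreover have "0 \<le> (\<Sum>t\<in>UNIV. \<beta> t * (total_load (l - z) t)\<^sup>2)"
    by (intro sum_nonneg mult_nonneg_nonneg less_imp_le[OF \<beta>_pos]) simp
  ultimately show ?thesis
    using potential_diff[of l z] by (simp add: sum_nonneg)
qed

lemma Min_\<beta>_pos: "0 < (MIN t. \<beta> t)"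
  using \<beta>_pos by simp

text \<open>A minimizer of the potential over the compact set of profiles admits no profitable
  deviation, since potential and bill change equally.\<close>

lemma ex1_nash_equilibrium:
  fixes X :: "'n::finite \<Rightarrow> (real ^ 't) set"
  assumes "\<And>n. convex (X n)" "\<And>n. compact (X n)" "\<And>n. X n \<noteq> {}"
  shows "\<exists>!z. nash_equilibrium c X z"
proof (rule ex_ex1I)
  have "(\<chi> n. SOME x. x \<in> X n) \<in> profiles X"
    using assms(3) by (auto simp: profiles_def some_in_eq)
  moreover have "continuous_on (profiles X) potential"
    unfolding potential_def total_load_def by (intro continuous_intros)
  ultimately obtain z where z: "z \<in> profiles X" "\<And>l. l \<in> profiles X \<Longrightarrow> potential z \<le> potential l"
    using continuous_attains_inf[OF compact_profiles[of X]] assms(2) by blast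
  have "deviate z n x \<in> profiles X" if "x \<in> X n" for n x
    using that z(1) by (auto simp: profiles_def deviate_def)
  then have "bill c n z \<le> bill c n (deviate z n x)" if "x \<in> X n" for n x
    using z(2) potential_deviate[of z n x] that by fastforce
  then show "\<exists>z. nash_equilibrium c X z"
    using z(1) by (auto simp: nash_equilibrium_def)
next
  fix y z assume y: "nash_equilibrium c X y" and z: "nash_equilibrium c X z"
  \<comment> \<open>The potential gaps of the two equilibria, taken in both directions,
    cancel.\<close>
  have "weighted_sq \<beta> (y - z) + weighted_sq \<beta> (z - y) \<le> 0"
    using potential_gap_nash[of X y z] potential_gap_nash[of X z y] assms(1) y z
    by (simp add: nash_equilibrium_def)
  then have "weighted_sq \<beta> (y - z) \<le> 0"
    using weighted_sq_nonneg[of \<beta>, OF \<beta>_pos, of "z - y"] by simp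
  then have "(MIN t. \<beta> t) * (norm (y - z))\<^sup>2 \<le> 0"
    using norm_sq_le_weighted_sq order_trans by blast
  then show "y = z"
    using Min_\<beta>_pos by (simp add: mult_le_0_iff)
qed

section \<open>One cycle of the dynamics and its well-posedness\<close>

text \<open>The new profile \<open>y\<close> occurs in its own condition, so solvability is a
  recursion over the players.\<close>

definition br_cycle ::
  "('n::{finite,linorder} \<Rightarrow> (real ^ 't) set) \<Rightarrow> real ^ 't ^ 'n::{finite,linorder} \<Rightarrow> real ^ 't ^ 'n::{finite,linorder} \<Rightarrow> bool" where
  "br_cycle X x y \<longleftrightarrow>
     (\<forall>n. y $ n \<in> best_response c X n ((\<Sum>m | m < n. y $ m) + (\<Sum>m | m > n. x $ m)))"

lemma cbrd_iff_br_cycle: "cbrd c X l0 l \<longleftrightarrow> l 0 = l0 \<and> (\<forall>k. br_cycle X (l k) (l (Suc k)))"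
  by (simp add: cbrd_def br_cycle_def)

lemma br_cycle_profiles: "br_cycle X x y \<Longrightarrow> y \<in> profiles X"
  by (auto simp: br_cycle_def profiles_def best_response_def is_arg_min_def)

text \<open>The response of \<open>n\<close> depends on the new profile only through players below
  \<open>n\<close>: well-founded recursion gives existence, and induction along the same order gives
  uniqueness.\<close>

lemma ex1_br_cycle:
  fixes X :: "'n::{finite,linorder} \<Rightarrow> (real ^ 't) set"
  assumes "\<And>n s. \<exists>!x. x \<in> best_response c X n s"
  shows "\<exists>!y. br_cycle X x y"
proof (rule ex_ex1I)
  let ?R = "{(m, n :: 'n). m < n}"
  \<comment> \<open>In a finite order, initial segments grow strictly in cardinality.\<close>
  have wf: "wf ?R"
    by (rule wf_subset[OF wf_measure[of "\<lambda>n. card {..<n}"]]) (auto intro!: psubset_card_mono)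
  have "\<exists>f. \<forall>n. f n \<in> best_response c X n ((\<Sum>m | m < n. f m) + (\<Sum>m | m > n. x $ m))"
  proof (rule dependent_wf_choice[OF wf, of "\<lambda>f n r.
      r \<in> best_response c X n ((\<Sum>m | m < n. f m) + (\<Sum>m | m > n. x $ m))"])
    fix f g :: "'n \<Rightarrow> real ^ 't" and n r
    assume "\<And>m. (m, n) \<in> ?R \<Longrightarrow> f m = g m"
    then have "(\<Sum>m | m < n. f m) = (\<Sum>m | m < n. g m)"
      by (intro sum.cong) auto
    then show "(r \<in> best_response c X n ((\<Sum>m | m < n. f m) + (\<Sum>m | m > n. x $ m))) =
        (r \<in> best_response c X n ((\<Sum>m | m < n. g m) + (\<Sum>m | m > n. x $ m)))"
      by simp
  qed (use assms in blast)
  then obtain f where "\<And>n. f n \<in> best_response c X n ((\<Sum>m | m < n. f m) + (\<Sum>m | m > n. x $ m))"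
    by blast
  then have "br_cycle X x (\<chi> n. f n)"
    by (simp add: br_cycle_def)
  then show "\<exists>y. br_cycle X x y" ..
  fix y z assume y: "br_cycle X x y" and z: "br_cycle X x z"
  have "y $ n = z $ n" for n
    using wf
  proof (induction n rule: wf_induct_rule)
    case (less n)
    then have "(\<Sum>m | m < n. y $ m) = (\<Sum>m | m < n. z $ m)"
      by (intro sum.cong) auto
    then show ?case
      using y z assms[of n] unfolding br_cycle_def by metis
  qed
  then show "y = z"
    by (simp add: vec_eq_iff)
qed

lemma ex1_cbrd:
  assumes "\<And>n s. \<exists>!x. x \<in> best_response c X n s"
  shows "\<exists>!l. cbrd c X l0 l"
proof -
  obtain f where f: "\<And>x y. br_cycle X x y \<longleftrightarrow> y = f x"
    using ex1_br_cycle[OF assms] by metis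
  show ?thesis
  proof
    show "cbrd c X l0 (\<lambda>k. (f ^^ k) l0)"
      by (simp add: cbrd_iff_br_cycle f)
    fix l assume l: "cbrd c X l0 l"
    show "l = (\<lambda>k. (f ^^ k) l0)"
    proof
      fix k show "l k = (f ^^ k) l0"
        using l by (induction k) (auto simp: cbrd_iff_br_cycle f)
    qed
  qed
qed

section \<open>Descent and potential gap over one cycle\<close>

text \<open>
  The marginal cost of \<open>n\<close> at \<open>y\<close> differs from the one seen when \<open>n\<close> plays by the moves that the
  players above \<open>n\<close> make afterwards.
\<close>

lemma br_cycle_variational:
  fixes X :: "'n::{finite,linorder} \<Rightarrow> (real ^ 't) set"
  assumes "\<And>n. convex (X n)" "br_cycle X x y" "z \<in> profiles X"
  shows "- (\<Sum>t\<in>UNIV. \<beta> t * (\<Sum>n\<in>UNIV. (z - y) $ n $ t * (\<Sum>m | m > n. (x - y) $ m $ t)))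
    \<le> (\<Sum>n\<in>UNIV. \<Sum>t\<in>UNIV. (\<alpha> t + \<beta> t * (total_load y t + y $ n $ t)) * (z $ n $ t - y $ n $ t))"
proof -
  have "- (\<Sum>t\<in>UNIV. \<beta> t * ((z - y) $ n $ t * (\<Sum>m | m > n. (x - y) $ m $ t)))
    \<le> (\<Sum>t\<in>UNIV. (\<alpha> t + \<beta> t * (total_load y t + y $ n $ t)) * (z $ n $ t - y $ n $ t))" for n
  proof -
    let ?s = "(\<Sum>m | m < n. y $ m) + (\<Sum>m | m > n. x $ m)"
    have "y $ n \<in> best_response c X n ?s" "z $ n \<in> X n"
      using assms by (auto simp: br_cycle_def profiles_def)
    then have "0 \<le> (\<Sum>t\<in>UNIV. (\<alpha> t + \<beta> t * (?s $ t + 2 * y $ n $ t)) * (z $ n $ t - y $ n $ t))"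
      using best_response_iff[of X n "y $ n" ?s] assms(1) by blast
    also have "\<dots> = (\<Sum>t\<in>UNIV. (\<alpha> t + \<beta> t * (total_load y t + y $ n $ t)) * (z $ n $ t - y $ n $ t))
        + (\<Sum>t\<in>UNIV. \<beta> t * ((z - y) $ n $ t * (\<Sum>m | m > n. (x - y) $ m $ t)))"
      unfolding sum.distrib[symmetric] total_load_split[where n = n]
      by (intro sum.cong refl) (simp add: sum_subtractf algebra_simps)
    finally show ?thesis by simp
  qed
  then have "(\<Sum>n\<in>UNIV. - (\<Sum>t\<in>UNIV. \<beta> t * ((z - y) $ n $ t * (\<Sum>m | m > n. (x - y) $ m $ t))))
    \<le> (\<Sum>n\<in>UNIV. \<Sum>t\<in>UNIV. (\<alpha> t + \<beta> t * (total_load y t + y $ n $ t)) * (z $ n $ t - y $ n $ t))"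
    by (rule sum_mono)
  moreover have "(\<Sum>n\<in>UNIV. \<Sum>t\<in>UNIV. \<beta> t * ((z - y) $ n $ t * (\<Sum>m | m > n. (x - y) $ m $ t)))
    = (\<Sum>t\<in>UNIV. \<beta> t * (\<Sum>n\<in>UNIV. (z - y) $ n $ t * (\<Sum>m | m > n. (x - y) $ m $ t)))"
    unfolding sum_distrib_left by (rule sum.swap)
  ultimately show ?thesis
    unfolding sum_negf by (simp only:)
qed

text \<open>Testing against \<open>x\<close> itself, the ordered-pair sum cancels the cross terms of
  the squared total-load change, leaving two halves of the weighted norm.\<close>

lemma br_cycle_decrease:
  fixes X :: "'n::{finite,linorder} \<Rightarrow> (real ^ 't) set"
  assumes "\<And>n. convex (X n)" "br_cycle X x y" "x \<in> profiles X"
  shows "weighted_sq \<beta> (x - y) \<le> potential x - potential y"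
proof -
  have distrib: "b * (s + 2 * p) = b * s + 2 * (b * p)" for b s p :: real
    by algebra
  have "(\<Sum>t\<in>UNIV. \<beta> t * (total_load (x - y) t)\<^sup>2) = weighted_sq \<beta> (x - y)
    + 2 * (\<Sum>t\<in>UNIV. \<beta> t * (\<Sum>n\<in>UNIV. (x - y) $ n $ t * (\<Sum>m | m > n. (x - y) $ m $ t)))"
    unfolding total_load_def square_sum_linorder weighted_sq_def distrib sum.distrib
      sum_distrib_left[symmetric] ..
  then show ?thesis
    using br_cycle_variational[OF assms] potential_diff[of x y] by linarith
qed

text \<open>Young's inequality splits the cross term; its \<open>z - y\<close> half is absorbed by
  the strong convexity of the potential, so only the length of the cycle's move remains.\<close>

lemma br_cycle_gap:
  fixes X :: "'n::{finite,linorder} \<Rightarrow> (real ^ 't) set"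
  assumes "\<And>n. convex (X n)" "br_cycle X x y" "z \<in> profiles X"
  shows "potential y - potential z \<le> (real CARD('n))\<^sup>2 / 2 * weighted_sq \<beta> (x - y)"
proof -
  let ?N = "real CARD('n)"
  let ?D = "\<lambda>n t. \<Sum>m | m > n. (x - y) $ m $ t"
  have distrib: "b * (s / 2 + k * p) = b * s / 2 + k * (b * p)" for b s k p :: real
    by (simp add: algebra_simps)
  have pair: "e * d \<le> e\<^sup>2 / 2 + d\<^sup>2 / 2" for e d :: real
    using sum_squares_bound[of e d] by simp
  \<comment> \<open>Cauchy-Schwarz over at most \<open>?N\<close> later players gives one factor
    \<open>?N\<close>; summing over \<open>n\<close> below gives the second.\<close>
  have D: "(?D n t)\<^sup>2 \<le> ?N * (\<Sum>m\<in>UNIV. ((x - y) $ m $ t)\<^sup>2)" for n t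
  proof -
    have "(?D n t)\<^sup>2 \<le> real (card {m. m > n}) * (\<Sum>m | m > n. ((x - y) $ m $ t)\<^sup>2)"
      using sum_squared_le_sum_of_squares[of "\<lambda>m. (x - y) $ m $ t" "{m. m > n}"] by (simp only: mult.commute)
    also have "\<dots> \<le> ?N * (\<Sum>m\<in>UNIV. ((x - y) $ m $ t)\<^sup>2)"
      by (intro mult_mono sum_mono2 of_nat_mono card_mono sum_nonneg) auto
    finally show ?thesis .
  qed
  have "(\<Sum>n\<in>UNIV. (z - y) $ n $ t * ?D n t) \<le> (\<Sum>n\<in>UNIV. ((z - y) $ n $ t)\<^sup>2) / 2
      + ?N\<^sup>2 / 2 * (\<Sum>m\<in>UNIV. ((x - y) $ m $ t)\<^sup>2)" for t
  proof -
    have "(\<Sum>n\<in>UNIV. (z - y) $ n $ t * ?D n t)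
        \<le> (\<Sum>n\<in>UNIV. ((z - y) $ n $ t)\<^sup>2 / 2 + ?N * (\<Sum>m\<in>UNIV. ((x - y) $ m $ t)\<^sup>2) / 2)"
      by (intro sum_mono order_trans[OF pair] add_left_mono divide_right_mono D) simp
    then show ?thesis
      by (simp add: sum.distrib sum_divide_distrib power2_eq_square algebra_simps)
  qed
  then have "(\<Sum>t\<in>UNIV. \<beta> t * (\<Sum>n\<in>UNIV. (z - y) $ n $ t * ?D n t))
      \<le> (\<Sum>t\<in>UNIV. \<beta> t * ((\<Sum>n\<in>UNIV. ((z - y) $ n $ t)\<^sup>2) / 2
          + ?N\<^sup>2 / 2 * (\<Sum>m\<in>UNIV. ((x - y) $ m $ t)\<^sup>2)))"
    by (intro sum_mono mult_left_mono less_imp_le[OF \<beta>_pos])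
  also have "\<dots> = weighted_sq \<beta> (z - y) / 2 + ?N\<^sup>2 / 2 * weighted_sq \<beta> (x - y)"
    unfolding weighted_sq_def distrib sum.distrib sum_distrib_left[symmetric]
      sum_divide_distrib[symmetric] ..
  finally have "(\<Sum>t\<in>UNIV. \<beta> t * (\<Sum>n\<in>UNIV. (z - y) $ n $ t * ?D n t))
      \<le> weighted_sq \<beta> (z - y) / 2 + ?N\<^sup>2 / 2 * weighted_sq \<beta> (x - y)" .
  moreover have "0 \<le> (\<Sum>t\<in>UNIV. \<beta> t * (total_load (z - y) t)\<^sup>2)"
    by (intro sum_nonneg mult_nonneg_nonneg less_imp_le[OF \<beta>_pos]) simp
  ultimately show ?thesis
    using br_cycle_variational[OF assms] potential_diff[of z y] by linarith
qed

section \<open>Convergence rate of the iterates\<close>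

text \<open>Allows the initial gap to be bounded by \<open>potential l0\<close> alone, independently
  of the equilibrium.\<close>

lemma potential_nonneg:
  assumes "\<And>n t. 0 \<le> l $ n $ t"
  shows "0 \<le> potential l"
  unfolding potential_def total_load_def
  by (intro sum_nonneg add_nonneg_nonneg mult_nonneg_nonneg divide_nonneg_nonneg
      less_imp_le[OF \<beta>_pos] less_imp_le[OF \<alpha>_pos] zero_le_power2 assms) simp

lemma cbrd_profiles:
  assumes "cbrd c X l0 l" "l0 \<in> profiles X"
  shows "l k \<in> profiles X"
  using assms by (cases k) (auto simp: cbrd_iff_br_cycle intro: br_cycle_profiles)

text \<open>The one-cycle gaps telescope; keeping \<open>potential (l k)\<close> on the right makes
  the induction close.\<close>

lemma cbrd_potential_gap:
  fixes X :: "'n::{finite,linorder} \<Rightarrow> (real ^ 't) set"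
  assumes conv: "\<And>n. convex (X n)" and cbrd: "cbrd c X l0 l" and l0: "l0 \<in> profiles X"
    and z: "z \<in> profiles X"
  shows "real k * (potential (l k) - potential z)
    \<le> (real CARD('n))\<^sup>2 / 2 * (potential l0 - potential (l k))"
proof (induction k)
  case 0
  then show ?case using cbrd by (simp add: cbrd_iff_br_cycle)
next
  case (Suc k)
  let ?K = "(real CARD('n))\<^sup>2 / 2"
  have cyc: "br_cycle X (l k) (l (Suc k))"
    using cbrd by (simp add: cbrd_iff_br_cycle)
  have dec: "weighted_sq \<beta> (l k - l (Suc k)) \<le> potential (l k) - potential (l (Suc k))"
    using br_cycle_decrease[OF conv cyc] cbrd_profiles[OF cbrd l0] .
  \<comment> \<open>Monotonicity carries the weight \<open>k\<close> from the old gap to the new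
    one.\<close>
  have "potential (l (Suc k)) \<le> potential (l k)"
    using dec weighted_sq_nonneg[of \<beta>, OF \<beta>_pos, of "l k - l (Suc k)"] by simp
  then have "real k * (potential (l (Suc k)) - potential z) \<le> real k * (potential (l k) - potential z)"
    by (intro mult_left_mono) auto
  moreover have "potential (l (Suc k)) - potential z \<le> ?K * (potential (l k) - potential (l (Suc k)))"
    by (rule order_trans[OF br_cycle_gap[OF conv cyc z]], rule mult_left_mono[OF dec]) simp
  ultimately show ?case
    using Suc.IH by (simp add: algebra_simps)
qed

lemma cbrd_rate:
  fixes X :: "'n::{finite,linorder} \<Rightarrow> (real ^ 't) set"
  assumes conv: "\<And>n. convex (X n)" and cbrd: "cbrd c X l0 l" and l0: "l0 \<in> profiles X"
    and nash: "nash_equilibrium c X z" and nonneg: "\<And>n t. 0 \<le> z $ n $ t" and k: "k \<ge> 1"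
  shows "norm (l k - z) \<le> sqrt (potential l0) * real CARD('n) / (sqrt (MIN t. \<beta> t) * sqrt (real k))"
proof -
  let ?N = "real CARD('n)" and ?b = "MIN t. \<beta> t"
  have z: "z \<in> profiles X"
    using nash by (simp add: nash_equilibrium_def)
  have gap: "weighted_sq \<beta> (l k - z) \<le> 2 * (potential (l k) - potential z)"
    using potential_gap_nash[OF conv nash] cbrd_profiles[OF cbrd l0] .
  \<comment> \<open>The potential is nonnegative at \<open>z\<close>, whose loads are nonnegative,
    and no smaller at \<open>l k\<close>.\<close>
  then have "0 \<le> potential (l k)"
    using potential_nonneg[OF nonneg] weighted_sq_nonneg[of \<beta>, OF \<beta>_pos, of "l k - z"] by simp
  have "?b * (norm (l k - z))\<^sup>2 \<le> 2 * (potential (l k) - potential z)"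
    using gap norm_sq_le_weighted_sq order_trans by blast
  then have "real k * (?b * (norm (l k - z))\<^sup>2) \<le> real k * (2 * (potential (l k) - potential z))"
    by (intro mult_left_mono) auto
  also have "\<dots> \<le> ?N\<^sup>2 * (potential l0 - potential (l k))"
    using cbrd_potential_gap[OF conv cbrd l0 z, of k] by (simp add: algebra_simps)
  also have "\<dots> \<le> ?N\<^sup>2 * potential l0"
    using \<open>0 \<le> potential (l k)\<close> by (intro mult_left_mono) auto
  finally have "(norm (l k - z))\<^sup>2 \<le> potential l0 * ?N\<^sup>2 / (?b * real k)"
    using Min_\<beta>_pos k by (simp add: field_simps)
  then have "norm (l k - z) \<le> sqrt (potential l0 * ?N\<^sup>2 / (?b * real k))"
    by (rule real_le_rsqrt)
  then show ?thesis
    by (simp add: real_sqrt_mult real_sqrt_divide)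
qed

end

theorem theorem3:
  fixes c :: "'t::finite \<Rightarrow> real \<Rightarrow> real"
    and \<alpha> \<beta> :: "'t \<Rightarrow> real"
    and l0 :: "real ^ 't ^ 'n::{finite,linorder}"
  assumes affine_price: "\<And>t x. c t x = \<alpha> t + \<beta> t * x"
    and \<alpha>_pos: "\<And>t. \<alpha> t > 0"
    and \<beta>_pos: "\<And>t. \<beta> t > 0"
  shows "\<exists>C::real. \<forall>(E :: 'n \<Rightarrow> real) (lo :: 'n \<Rightarrow> 't \<Rightarrow> real) (up :: 'n \<Rightarrow> 't \<Rightarrow> real) X.
      (\<forall>n t. 0 \<le> lo n t \<and> lo n t \<le> up n t) \<and> X = feasible E lo up \<and> (\<forall>n. X n \<noteq> {}) \<and>
      l0 \<in> profiles X \<longrightarrow>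
      (\<exists>!l. cbrd c X l0 l) \<and>
      (\<exists>!lNE. nash_equilibrium c X lNE) \<and>
      (\<forall>l lNE. cbrd c X l0 l \<and> nash_equilibrium c X lNE \<longrightarrow>
         l \<longlonglongrightarrow> lNE \<and>
         (\<forall>k\<ge>1. norm (l k - lNE) \<le>
            C * (sqrt (2 * (MAX t. \<beta> t)) * real CARD('n) / sqrt (2 * (MIN t. \<beta> t)))
              * (1 / sqrt (real k))))"
proof -
  interpret affine_prices c \<alpha> \<beta>
    by unfold_locales (fact assms)+
  let ?N = "real CARD('n)" and ?b = "MIN t. \<beta> t" and ?B = "MAX t. \<beta> t"
  \<comment> \<open>Dividing by \<open>?B\<close> offsets the factor sqrt M in the stated bound.
    Only \<open>l0\<close> and the prices enter, so the constant can be fixed before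
    \<open>E\<close>, \<open>lo\<close> and \<open>up\<close>.\<close>
  let ?C = "sqrt (potential l0 / ?B)"
  have "0 < ?B"
    using \<beta>_pos by (simp add: Max_gr_iff)
  have const: "sqrt (potential l0) * ?N / (sqrt ?b * sqrt (real k)) =
      ?C * (sqrt (2 * ?B) * ?N / sqrt (2 * ?b)) * (1 / sqrt (real k))" for k
    using \<open>0 < ?B\<close> by (simp add: real_sqrt_mult real_sqrt_divide)
  show ?thesis
  proof (rule exI[of _ ?C], intro allI impI, elim conjE)
    fix E :: "'n \<Rightarrow> real" and lo up :: "'n \<Rightarrow> 't \<Rightarrow> real" and X
    assume bounds: "\<forall>n t. 0 \<le> lo n t \<and> lo n t \<le> up n t" and X: "X = feasible E lo up"
      and nonempty: "\<forall>n. X n \<noteq> {}" and l0: "l0 \<in> profiles X"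
    have conv: "convex (X n)" and comp: "compact (X n)" for n
      by (simp_all add: X convex_feasible compact_feasible)
    have ex1_br: "\<exists>!x. x \<in> best_response c X n s" for n s
      using nonempty by (intro ex1_best_response conv comp) simp
    have rate: "norm (l k - lNE) \<le> ?C * (sqrt (2 * ?B) * ?N / sqrt (2 * ?b)) * (1 / sqrt (real k))"
      if cbrd: "cbrd c X l0 l" and nash: "nash_equilibrium c X lNE" and k: "k \<ge> 1" for l lNE k
    proof -
      have nonneg: "0 \<le> lNE $ n $ t" for n t
      proof -
        have "lo n t \<le> lNE $ n $ t"
          using nash by (simp add: nash_equilibrium_def profiles_def X feasible_def)
        with bounds show ?thesis
          using order_trans by blast
      qed
      show ?thesis
        using cbrd_rate[OF conv cbrd l0 nash nonneg k] unfolding const .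
    qed
    \<comment> \<open>Convergence follows from the rate by squeezing; the bound is available from
      \<open>k = 1\<close> on.\<close>
    have lim: "l \<longlonglongrightarrow> lNE" if "cbrd c X l0 l" "nash_equilibrium c X lNE" for l lNE
    proof (rule LIM_zero_cancel, rule Lim_null_comparison)
      show "\<forall>\<^sub>F k in sequentially. norm (l k - lNE)
          \<le> ?C * (sqrt (2 * ?B) * ?N / sqrt (2 * ?b)) * (1 / sqrt (real k))"
        using rate[OF that] by (rule eventually_sequentiallyI)
      have "filterlim (\<lambda>k. sqrt (real k)) at_top sequentially"
        by (rule filterlim_compose[OF sqrt_at_top filterlim_real_sequentially])
      then have "(\<lambda>k. 1 / sqrt (real k)) \<longlonglongrightarrow> 0"
        by (intro tendsto_divide_0[OF tendsto_const] filterlim_at_top_imp_at_infinity)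
      then show "(\<lambda>k. ?C * (sqrt (2 * ?B) * ?N / sqrt (2 * ?b)) * (1 / sqrt (real k))) \<longlonglongrightarrow> 0"
        by (rule tendsto_mult_right_zero)
    qed
    have "\<exists>!lNE. nash_equilibrium c X lNE"
      using nonempty by (intro ex1_nash_equilibrium conv comp) simp
    then show "(\<exists>!l. cbrd c X l0 l) \<and> (\<exists>!lNE. nash_equilibrium c X lNE) \<and>
      (\<forall>l lNE. cbrd c X l0 l \<and> nash_equilibrium c X lNE \<longrightarrow> l \<longlonglongrightarrow> lNE \<and>
        (\<forall>k\<ge>1. norm (l k - lNE)
          \<le> ?C * (sqrt (2 * ?B) * ?N / sqrt (2 * ?b)) * (1 / sqrt (real k))))"
      using ex1_cbrd[OF ex1_br] lim rate by (intro conjI allI impI; (elim conjE)?) simp_all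
  qed
qed

end
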